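(* Let $G$ be a graph and let $k\ge 1$ be the maximum depth of an induced complete binary tree in $G$. Then $$k\le 1+\log_2\left(|G|-\max_{\lambda}\mathrm{mult}(\lambda)\right),$$ where $\lambda$ ranges among the Laplacian, normalized Laplacian, and adjacency eigenvalues of $G$ (and $\mathrm{mult}(\lambda)$ is the multiplicity as an eigenvalue of the corresponding matrix). The upper bound is reached, for example, if $G$ is a complete binary tree of depth $2$.
   Context: A graph $G=(V,E)$ is a pair of finite sets with $V\neq\emptyset$ and $E$ a set of $2$-element subsets of $V$; $|G|=|V|$. The complete binary tree $T_{2,k}$ of depth $k\ge 1$ is defined inductively: $T_{2,1}$ is a graph with one vertex (regarded as its only leaf), and $T_{2,k+1}$ is obtained by attaching $2$ new vertices to each leaf of $T_{2,k}$, the new vertices being the leaves of $T_{2,k+1}$ (so $T_{2,k}$ has $2^k-1$ vertices and $2^{k-1}$ leaves). An induced complete binary tree of depth $k$ in $G$ is an induced subgraph isomorphic to $T_{2,k}$. With $A$ the adjacency matrix and $D$ the diagonal degree matrix, the Laplacian is $D-A$, and the normalized Laplacian is the standard one of spectral graph theory (as in Chung's book): the matrix with entry $-1/\sqrt{\deg v\deg w}$ for adjacent $v,w$, diagonal entry $1$ at each vertex of positive degree, and all other entries $0$, where $\deg v$ is the number of neighbors of $v$. *)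

theory Defs
  imports Complex_Main "Jordan_Normal_Form.Char_Poly"
begin

definition simple_graph :: "'a set \<Rightarrow> 'a set set \<Rightarrow> bool" where
  "simple_graph V E \<longleftrightarrow> finite V \<and> V \<noteq> {} \<and> (\<forall>e\<in>E. e \<subseteq> V \<and> card e = 2)"

definition graph_iso :: "'a set \<Rightarrow> 'a set set \<Rightarrow> 'b set \<Rightarrow> 'b set set \<Rightarrow> bool" where
  "graph_iso V E V' E' \<longleftrightarrow>
     (\<exists>f. bij_betw f V V' \<and> (\<forall>u\<in>V. \<forall>v\<in>V. {u, v} \<in> E \<longleftrightarrow> {f u, f v} \<in> E'))"

definition induced_edges :: "'a set set \<Rightarrow> 'a set \<Rightarrow> 'a set set" where
  "induced_edges E W = {e \<in> E. e \<subseteq> W}"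

text \<open>A concrete complete binary tree of depth \<open>k \<ge> 1\<close> on Boolean lists: the root is \<open>[]\<close> and the
  two new vertices attached to a leaf \<open>l\<close> are \<open>True # l\<close> and \<open>False # l\<close>.
  Depth \<open>0\<close> is a dummy case (no vertices).\<close>

fun cbt_leaves :: "nat \<Rightarrow> bool list set" where
  "cbt_leaves 0 = {}"
| "cbt_leaves (Suc 0) = {[]}"
| "cbt_leaves (Suc (Suc k)) = {b # l | b l. l \<in> cbt_leaves (Suc k)}"

fun cbt_verts :: "nat \<Rightarrow> bool list set" where
  "cbt_verts 0 = {}"
| "cbt_verts (Suc 0) = {[]}"
| "cbt_verts (Suc (Suc k)) = cbt_verts (Suc k) \<union> {b # l | b l. l \<in> cbt_leaves (Suc k)}"

fun cbt_edges :: "nat \<Rightarrow> bool list set set" where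
  "cbt_edges 0 = {}"
| "cbt_edges (Suc 0) = {}"
| "cbt_edges (Suc (Suc k)) = cbt_edges (Suc k) \<union> {{l, b # l} | b l. l \<in> cbt_leaves (Suc k)}"

definition is_cbt :: "'a set \<Rightarrow> 'a set set \<Rightarrow> nat \<Rightarrow> bool" where
  "is_cbt V E k \<longleftrightarrow> k \<ge> 1 \<and> graph_iso V E (cbt_verts k) (cbt_edges k)"

definition has_induced_cbt :: "'a set \<Rightarrow> 'a set set \<Rightarrow> nat \<Rightarrow> bool" where
  "has_induced_cbt V E k \<longleftrightarrow> (\<exists>W\<subseteq>V. is_cbt W (induced_edges E W) k)"

definition vertex_degree :: "'a set set \<Rightarrow> 'a \<Rightarrow> nat" where
  "vertex_degree E v = card {w. {v, w} \<in> E}"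

definition adj_entry :: "'a set set \<Rightarrow> 'a \<Rightarrow> 'a \<Rightarrow> real" where
  "adj_entry E v w = (if {v, w} \<in> E then 1 else 0)"

definition lap_entry :: "'a set set \<Rightarrow> 'a \<Rightarrow> 'a \<Rightarrow> real" where
  "lap_entry E v w = (if v = w then real (vertex_degree E v) else 0) - adj_entry E v w"

definition norm_lap_entry :: "'a set set \<Rightarrow> 'a \<Rightarrow> 'a \<Rightarrow> real" where
  "norm_lap_entry E v w =
     (if v = w then (if vertex_degree E v > 0 then 1 else 0)
      else if {v, w} \<in> E then - 1 / sqrt (real (vertex_degree E v) * real (vertex_degree E w))
      else 0)"

text \<open>Matrices are indexed by \<open>{..<n}\<close>, so the vertices are enumerated by an arbitrary choice.
  Different enumerations give matrices conjugate by a permutation matrix, hence the same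
  eigenvalues and multiplicities.\<close>

definition vertex_enum :: "'a set \<Rightarrow> nat \<Rightarrow> 'a" where
  "vertex_enum V = (SOME f. bij_betw f {..<card V} V)"

definition vertex_matrix :: "'a set \<Rightarrow> ('a \<Rightarrow> 'a \<Rightarrow> real) \<Rightarrow> real mat" where
  "vertex_matrix V M =
     mat (card V) (card V) (\<lambda>(i, j). M (vertex_enum V i) (vertex_enum V j))"

definition adjacency_matrix :: "'a set \<Rightarrow> 'a set set \<Rightarrow> real mat" where
  "adjacency_matrix V E = vertex_matrix V (adj_entry E)"

definition laplacian_matrix :: "'a set \<Rightarrow> 'a set set \<Rightarrow> real mat" where
  "laplacian_matrix V E = vertex_matrix V (lap_entry E)"

definition normalized_laplacian_matrix :: "'a set \<Rightarrow> 'a set set \<Rightarrow> real mat" where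
  "normalized_laplacian_matrix V E = vertex_matrix V (norm_lap_entry E)"

text \<open>Multiplicity is the algebraic one. The three matrices are real symmetric, so all their
  complex eigenvalues are real and this equals the dimension of the eigenspace.\<close>

definition eigenvalue_mult :: "real mat \<Rightarrow> real \<Rightarrow> nat" where
  "eigenvalue_mult A \<mu> = Polynomial.order \<mu> (char_poly A)"

definition max_mult :: "'a set \<Rightarrow> 'a set set \<Rightarrow> nat" where
  "max_mult V E =
     Max {eigenvalue_mult A \<mu> | A \<mu>.
       A \<in> {laplacian_matrix V E, normalized_laplacian_matrix V E, adjacency_matrix V E} \<and>
       eigenvalue A \<mu>}"

end

theory Submission
  imports Defs
    "Jordan_Normal_Form.Jordan_Normal_Form_Existence"
    "Jordan_Normal_Form.Jordan_Normal_Form_Uniqueness"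
    "Jordan_Normal_Form.DL_Rank"
begin

text \<open>All three matrices are real symmetric and have a nonzero off-diagonal entry exactly at the
  edges. For such a matrix \<open>A\<close> the multiplicity of \<open>\<mu>\<close> is the dimension of the kernel of
  \<open>A - \<mu> I\<close> (\<open>order_char_poly_symmetric\<close>), so \<open>|G| - mult(\<mu>)\<close> is the rank of \<open>A - \<mu> I\<close>. It is
  therefore enough to exhibit, for every \<open>\<mu>\<close> at once, a triangular submatrix of \<open>A - \<mu> I\<close> of size
  \<open>2^(k-1)\<close> with nonzero diagonal. The entries of \<open>A - \<mu> I\<close> on the diagonal are unknown, so the
  diagonal of the submatrix has to consist of edges and its triangular shape must come from the
  graph alone: this is a zero forcing argument (\<open>triangular_null_vector\<close>,
  \<open>eigenvalue_mult_add_card_le\<close>).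

  In an induced complete binary tree of depth \<open>k \<ge> 2\<close>, take as rows the \<open>2^(k-1) - 1\<close> inner
  vertices and the leftmost leaf. Each vertex on the path from the leftmost leaf up to, but
  excluding, the root is paired with its parent as column; each other row is paired with its
  right child. Processing first that path upwards and then the remaining rows by increasing
  depth, each row meets only its own column and columns that were already treated
  (\<open>forcing_rank_decreases\<close>). Since the tree is induced, edges leaving the tree only reach
  vertices that are not columns, and edges of \<open>G\<close> between tree vertices are tree edges.

  For \<open>k = 1\<close> the bound says that the logarithm is nonnegative; for an edgeless graph its argument
  is \<open>0\<close>, where \<open>log\<close> has the value \<open>0\<close>. For the tree of depth \<open>2\<close> the rank argument gives
  multiplicities at most \<open>3 - 2 = 1\<close>, and the Laplacian has the eigenvalue \<open>0\<close>, so the maximum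
  multiplicity is exactly \<open>1\<close>.\<close>

section \<open>Multiplicities of eigenvalues of real symmetric matrices\<close>

text \<open>If a basis of the kernel had more than \<open>n - card S\<close> elements, the \<open>n - card S\<close> linear conditions
  of vanishing outside \<open>S\<close> would have a nontrivial solution among its linear combinations.\<close>

lemma kernel_dim_add_card_le:
  fixes B :: "'f :: field mat"
  assumes B: "B \<in> carrier_mat n n" and S: "S \<subseteq> {..<n}"
    and inj: "\<And>x. x \<in> mat_kernel B \<Longrightarrow> (\<And>i. i < n \<Longrightarrow> i \<notin> S \<Longrightarrow> x $ i = 0) \<Longrightarrow> x = 0\<^sub>v n"
  shows "kernel_dim B + card S \<le> n"
proof (rule ccontr)
  assume large: "\<not> ?thesis"
  interpret kernel n n B by unfold_locales (rule B)
  obtain X where X: "finite X" "basis X"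
    using kernel_basis_exists[OF B] by auto
  define d where "d = card X"
  have d: "kernel_dim B = d"
    using X by (simp add: d_def Ker.dim_basis)
  obtain bs where bs: "set bs = X" "distinct bs"
    using finite_distinct_list[OF X(1)] by blast
  have len: "length bs = d"
    using bs d_def distinct_card by metis
  have XK: "X \<subseteq> mat_kernel B" and indep: "\<not> Ker.lin_dep X"
    using X(2) unfolding Ker.basis_def by auto
  have Xn: "X \<subseteq> carrier_vec n"
    using XK mat_kernel_carrier[OF B] by blast
  define U where "U = mat_of_cols n bs"
  have U: "U \<in> carrier_mat n d"
    unfolding U_def using len by auto
  have cols: "cols U = bs"
    unfolding U_def using bs Xn by (intro cols_mat_of_cols) auto
  have BU: "B * U = 0\<^sub>m n d"
  proof (rule eq_matI)
    fix i j assume "i < dim_row (0\<^sub>m n d)" "j < dim_col (0\<^sub>m n d)"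
    then have ij: "i < n" "j < d" by auto
    have "col U j \<in> X"
      using ij U cols bs(1) len by (metis carrier_matD(2) cols_nth nth_mem)
    then have "B *\<^sub>v col U j = 0\<^sub>v n"
      using XK mat_kernelD(2)[OF B] by blast
    then have "(B *\<^sub>v col U j) $ i = 0"
      using ij by simp
    then show "(B * U) $$ (i, j) = 0\<^sub>m n d $$ (i, j)"
      using ij B U by simp
  qed (use B U in auto)
  define cs where "cs = sorted_list_of_set ({..<n} - S)"
  have cs: "set cs = {..<n} - S" "length cs = n - card S"
    unfolding cs_def using S by (auto simp: card_Diff_subset finite_subset)
  have short: "length cs < d"
    using large d cs(2) card_mono[OF _ S] by simp
  \<comment> \<open>\<open>W\<close> consists of the rows of \<open>U\<close> outside \<open>S\<close>, filled up with zero rows to a square matrix;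
    its determinant vanishes because at least one zero row is needed.\<close>
  define W where "W = mat d d (\<lambda>(i, j). if i < length cs then U $$ (cs ! i, j) else 0)"
  have W: "W \<in> carrier_mat d d" unfolding W_def by simp
  have "W = mat\<^sub>r d d (\<lambda>i. if i = d - 1 then 0\<^sub>v d else row W i)"
    using short by (intro eq_matI) (auto simp: W_def)
  moreover have "det (mat\<^sub>r d d (\<lambda>i. if i = d - 1 then 0\<^sub>v d else row W i)) = 0"
    using short W by (intro det_row_0) auto
  ultimately have "det W = 0" by simp
  then obtain c where c: "c \<in> carrier_vec d" "c \<noteq> 0\<^sub>v d" "W *\<^sub>v c = 0\<^sub>v d"
    using det_0_iff_vec_prod_zero_field[OF W] by blast
  have ker: "U *\<^sub>v c \<in> mat_kernel B"
  proof (rule mat_kernelI[OF B])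
    show "B *\<^sub>v (U *\<^sub>v c) = 0\<^sub>v n"
      unfolding assoc_mult_mat_vec[OF B U c(1), symmetric] BU
      using c(1) by (intro eq_vecI) auto
  qed (use U c in auto)
  have "U *\<^sub>v c = 0\<^sub>v n"
  proof (rule inj[OF ker])
    fix i assume "i < n" "i \<notin> S"
    then obtain q where q: "q < length cs" "cs ! q = i"
      using cs(1) by (metis DiffI in_set_conv_nth lessThan_iff)
    have "row W q = row U i"
      using q short U \<open>i < n\<close> by (intro eq_vecI) (auto simp: W_def)
    moreover have "(W *\<^sub>v c) $ q = 0"
      using c(3) q short by simp
    ultimately show "(U *\<^sub>v c) $ i = 0"
      using q short U W \<open>i < n\<close> by simp
  qed
  then have "NC.lin_dep (set (cols U))"
    using NC.lin_depI[OF U c(1,2)] cols bs(2) by simp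
  then show False
    using indep lindep_same[OF XK] cols bs(1) by simp
qed

text \<open>The reason is \<open>|Av|\<^sup>2 = \<langle>Av, Av\<rangle> = \<langle>v, A(Av)\<rangle>\<close>. Complex vectors are needed because the lemma
  is applied to a Jordan normal form, which exists over \<open>\<complex>\<close>.\<close>

lemma symmetric_kernel_square:
  fixes A :: "real mat" and v :: "complex vec"
  assumes A: "A \<in> carrier_mat n n"
    and sym: "\<And>i j. i < n \<Longrightarrow> j < n \<Longrightarrow> A $$ (i, j) = A $$ (j, i)"
    and v: "v \<in> carrier_vec n"
    and zero: "map_mat complex_of_real A *\<^sub>v (map_mat complex_of_real A *\<^sub>v v) = 0\<^sub>v n"
  shows "map_mat complex_of_real A *\<^sub>v v = 0\<^sub>v n"
proof -
  let ?B = "map_mat complex_of_real A"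
  define w where "w = ?B *\<^sub>v v"
  have w: "w $ i = (\<Sum>j<n. of_real (A $$ (i, j)) * v $ j)" if "i < n" for i
    using that A v by (simp add: w_def scalar_prod_def atLeast0LessThan)
  have z: "(\<Sum>j<n. of_real (A $$ (i, j)) * w $ j) = 0" if "i < n" for i
  proof -
    have "(?B *\<^sub>v w) $ i = 0"
      using zero that by (simp add: w_def)
    then show ?thesis
      using that A by (simp add: w_def scalar_prod_def atLeast0LessThan)
  qed
  have "complex_of_real (\<Sum>i<n. (cmod (w $ i))\<^sup>2) = (\<Sum>i<n. cnj (w $ i) * w $ i)"
    by (simp add: complex_norm_square mult.commute del: of_real_power)
  also have "\<dots> = (\<Sum>i<n. \<Sum>j<n. of_real (A $$ (i, j)) * cnj (v $ j) * w $ i)"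
    by (intro sum.cong refl) (simp add: w sum_distrib_right)
  also have "\<dots> = (\<Sum>j<n. \<Sum>i<n. of_real (A $$ (i, j)) * cnj (v $ j) * w $ i)"
    by (rule sum.swap)
  also have "\<dots> = (\<Sum>j<n. cnj (v $ j) * (\<Sum>i<n. of_real (A $$ (j, i)) * w $ i))"
    by (intro sum.cong refl) (simp add: sum_distrib_left sym mult_ac)
  also have "\<dots> = 0"
    by (simp add: z)
  finally have "(\<Sum>i<n. (cmod (w $ i))\<^sup>2) = 0"
    by (simp only: of_real_eq_0_iff)
  then have "\<forall>i<n. w $ i = 0"
    by (simp add: sum_nonneg_eq_0_iff)
  then show ?thesis
    using A by (intro eq_vecI) (auto simp: w_def)
qed

text \<open>Algebraic and geometric multiplicity agree: the order of \<open>\<mu>\<close> is the dimension of the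
  generalized eigenspace, which by \<open>symmetric_kernel_square\<close> is no larger than the eigenspace.\<close>

lemma order_char_poly_symmetric:
  fixes A :: "real mat"
  assumes A: "A \<in> carrier_mat n n"
    and sym: "\<And>i j. i < n \<Longrightarrow> j < n \<Longrightarrow> A $$ (i, j) = A $$ (j, i)"
  shows "Polynomial.order \<mu> (char_poly A) =
    kernel_dim (map_mat complex_of_real (char_matrix A \<mu>))"
proof -
  interpret hom: inj_idom_divide_hom complex_of_real
    by unfold_locales (auto simp: of_real_divide)
  interpret map_poly_inj_idom_divide_hom complex_of_real ..
  let ?A = "map_mat complex_of_real A"
  have A': "?A \<in> carrier_mat n n" using A by simp
  define B where "B = map_mat complex_of_real (char_matrix A \<mu>)"
  have B: "B \<in> carrier_mat n n" unfolding B_def using A by simp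
  have B_eq: "char_matrix ?A (complex_of_real \<mu>) = B"
    unfolding B_def char_matrix_def using A by (intro eq_matI) auto
  obtain as where "char_poly ?A = (\<Prod>a\<leftarrow>as. [:- a, 1:])"
    using char_poly_factorized[OF A'] by blast
  then obtain n_as where jnf: "jordan_nf ?A n_as"
    using jordan_nf_exists[OF A'] by blast
  let ?sizes = "map fst (filter (\<lambda>na. snd na = complex_of_real \<mu>) n_as)"
  \<comment> \<open>An exponent at least as large as all Jordan blocks of \<open>\<mu>\<close>, so that the kernel of
    \<open>B ^\<^sub>m m\<close> is the full generalized eigenspace; it is positive so that \<open>pow\<close> applies.\<close>
  define m where "m = Suc (sum_list ?sizes)"
  have sq: "B *\<^sub>v v = 0\<^sub>v n" if "v \<in> carrier_vec n" "B *\<^sub>v (B *\<^sub>v v) = 0\<^sub>v n" for v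
    unfolding B_def
    by (rule symmetric_kernel_square[of _ n])
       (use that A sym in \<open>auto simp: B_def char_matrix_def\<close>)
  have pow: "mat_kernel (B ^\<^sub>m Suc j) = mat_kernel B" for j
  proof (induction j)
    case (Suc j)
    have P: "B ^\<^sub>m Suc j \<in> carrier_mat n n" using B by (rule pow_carrier_mat)
    show ?case
    proof
      show "mat_kernel B \<subseteq> mat_kernel (B ^\<^sub>m Suc (Suc j))"
        using mat_kernel_mult_subset[OF B P] by simp
      show "mat_kernel (B ^\<^sub>m Suc (Suc j)) \<subseteq> mat_kernel B"
      proof
        fix v assume "v \<in> mat_kernel (B ^\<^sub>m Suc (Suc j))"
        then have v: "v \<in> carrier_vec n" "(B ^\<^sub>m Suc j * B) *\<^sub>v v = 0\<^sub>v n"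
          using mat_kernelD[OF mult_carrier_mat[OF P B]] by (metis pow_mat.simps(2))+
        have "B *\<^sub>v v \<in> mat_kernel (B ^\<^sub>m Suc j)"
          using v assoc_mult_mat_vec[OF P B v(1)] B
          by (intro mat_kernelI[OF P]) auto
        then have "B *\<^sub>v (B *\<^sub>v v) = 0\<^sub>v n"
          using Suc.IH mat_kernelD(2)[OF B] by blast
        then show "v \<in> mat_kernel B"
          using sq v(1) mat_kernelI[OF B] by blast
      qed
    qed
  qed (use B in simp)
  have "Polynomial.order \<mu> (char_poly A) = Polynomial.order (complex_of_real \<mu>) (char_poly ?A)"
    using order_hom[of \<mu> "char_poly A"] of_real_hom.char_poly_hom[OF A, where 'a = complex] by simp
  also have "\<dots> = sum_list ?sizes"
    by (rule jordan_nf_order[OF jnf])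
  also have "\<dots> = (\<Sum>s\<leftarrow>?sizes. min m s)"
  proof -
    have "min m s = s" if "s \<in> set ?sizes" for s
      using member_le_sum_list[OF that] by (simp add: m_def)
    then show ?thesis
      by (metis (no_types, lifting) map_idI)
  qed
  also have "\<dots> = dim_gen_eigenspace ?A (complex_of_real \<mu>) m"
    unfolding dim_gen_eigenspace[OF jnf] by (simp add: case_prod_unfold)
  also have "\<dots> = kernel_dim (B ^\<^sub>m m)"
    unfolding dim_gen_eigenspace_def B_eq ..
  also have "\<dots> = kernel_dim B"
    unfolding kernel_dim_def m_def pow using B by simp
  finally show ?thesis unfolding B_def .
qed

section \<open>Zero forcing\<close>

lemma edge_ends_distinct: "simple_graph V E \<Longrightarrow> {u, v} \<in> E \<Longrightarrow> u \<in> V \<and> v \<in> V \<and> u \<noteq> v"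
  unfolding simple_graph_def by fastforce

text \<open>The common shape of the three matrices. The diagonal is left arbitrary, hence subtracting
  a multiple of the identity does not lead out of this class.\<close>

definition symmetric_edge_weights :: "'a set \<Rightarrow> 'a set set \<Rightarrow> ('a \<Rightarrow> 'a \<Rightarrow> real) \<Rightarrow> bool" where
  "symmetric_edge_weights V E M \<longleftrightarrow>
     (\<forall>v\<in>V. \<forall>w\<in>V. M v w = M w v \<and> (v \<noteq> w \<longrightarrow> (M v w \<noteq> 0 \<longleftrightarrow> {v, w} \<in> E)))"

lemma
  assumes "symmetric_edge_weights V E M" "v \<in> V" "w \<in> V"
  shows edge_weight_commute: "M v w = M w v"
    and edge_weight_nonzero_iff: "v \<noteq> w \<Longrightarrow> M v w \<noteq> 0 \<longleftrightarrow> {v, w} \<in> E"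
  using assms unfolding symmetric_edge_weights_def by blast+

lemma vertex_enum_bij: "finite V \<Longrightarrow> bij_betw (vertex_enum V) {..<card V} V"
  unfolding vertex_enum_def
  by (rule someI_ex[of "\<lambda>f. bij_betw f {..<card V} V"])
    (rule ex_bij_betw_nat_finite[unfolded atLeast0LessThan])

lemma sum_vertex_enum: "finite V \<Longrightarrow> (\<Sum>i<card V. g (vertex_enum V i)) = (\<Sum>v\<in>V. g v)"
  using sum.reindex_bij_betw[OF vertex_enum_bij] .

text \<open>Back substitution: in the equation of row \<open>r i\<close>, all vertices with a nonzero coefficient
  other than \<open>c i\<close> lie outside \<open>c ` I\<close> or are columns of smaller rank \<open>p\<close>, so \<open>x\<close> vanishes there
  and the nonzero weight of the edge \<open>{r i, c i}\<close> forces \<open>x (c i) = 0\<close>. The row vertex itself is among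
  the vertices to control, as its coefficient \<open>M (r i) (r i) - \<mu>\<close> can have any value.\<close>

lemma triangular_null_vector:
  fixes x :: "'a \<Rightarrow> complex" and c r :: "'i \<Rightarrow> 'a" and p :: "'i \<Rightarrow> nat"
  assumes V: "finite V" and M: "symmetric_edge_weights V E M"
    and null: "\<And>v. v \<in> V \<Longrightarrow> (\<Sum>w\<in>V. of_real (M v w) * x w) = of_real \<mu> * x v"
    and supp: "\<And>v. v \<in> V \<Longrightarrow> v \<notin> c ` I \<Longrightarrow> x v = 0"
    and rV: "r ` I \<subseteq> V" and cV: "c ` I \<subseteq> V"
    and edge: "\<And>i. i \<in> I \<Longrightarrow> r i \<noteq> c i \<and> {r i, c i} \<in> E"
    and triangular: "\<And>i j. i \<in> I \<Longrightarrow> j \<in> I \<Longrightarrow> i \<noteq> j \<Longrightarrow> c j = r i \<or> {r i, c j} \<in> E \<Longrightarrow> p j < p i"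
    and "v \<in> V"
  shows "x v = 0"
proof -
  have "x (c i) = 0" if "i \<in> I" for i
    using that
  proof (induction "p i" arbitrary: i rule: less_induct)
    case less
    have r: "r i \<in> V" and c: "c i \<in> V"
      using less.prems rV cV by auto
    have rest: "x w = 0" if w: "w \<in> V" "w = r i \<or> {r i, w} \<in> E" "w \<noteq> c i" for w
    proof (cases "w \<in> c ` I")
      case True
      then obtain j where "j \<in> I" "w = c j" by auto
      then show ?thesis
        using less triangular[of i j] w by auto
    qed (use supp w in auto)
    have "(\<Sum>w\<in>V. of_real (M (r i) w) * x w) = of_real (M (r i) (c i)) * x (c i)"
    proof -
      have "of_real (M (r i) w) * x w = 0" if w: "w \<in> V - {c i}" for w
      proof (cases "w = r i \<or> {r i, w} \<in> E")
        case False
        then have "M (r i) w = 0"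
          using w edge_weight_nonzero_iff[OF M r, of w] by blast
        then show ?thesis by simp
      qed (use rest[of w] w in simp)
      then show ?thesis
        using sum.mono_neutral_right[of V "{c i}" "\<lambda>w. of_real (M (r i) w) * x w"] V c by simp
    qed
    moreover have "x (r i) = 0"
      using rest[of "r i"] r edge less.prems by auto
    ultimately have "of_real (M (r i) (c i)) * x (c i) = 0"
      using null[OF r] by simp
    moreover have "M (r i) (c i) \<noteq> 0"
      using edge_weight_nonzero_iff[OF M r c] edge[OF less.prems] by blast
    ultimately show ?case by simp
  qed
  then show ?thesis
    using supp \<open>v \<in> V\<close> by blast
qed

text \<open>An eigenvector vanishing outside the \<open>card I\<close> columns is zero by \<open>triangular_null_vector\<close>, so
  the eigenspace has codimension at least \<open>card I\<close>.\<close>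

lemma eigenvalue_mult_add_card_le:
  fixes c r :: "'i \<Rightarrow> 'a" and p :: "'i \<Rightarrow> nat"
  assumes V: "finite V" and M: "symmetric_edge_weights V E M"
    and rV: "r ` I \<subseteq> V" and cV: "c ` I \<subseteq> V" and c_inj: "inj_on c I"
    and edge: "\<And>i. i \<in> I \<Longrightarrow> r i \<noteq> c i \<and> {r i, c i} \<in> E"
    and triangular: "\<And>i j. i \<in> I \<Longrightarrow> j \<in> I \<Longrightarrow> i \<noteq> j \<Longrightarrow> c j = r i \<or> {r i, c j} \<in> E \<Longrightarrow> p j < p i"
  shows "eigenvalue_mult (vertex_matrix V M) \<mu> + card I \<le> card V"
proof -
  define n where "n = card V"
  define e where "e = vertex_enum V"
  have e: "bij_betw e {..<n} V"
    unfolding e_def n_def by (rule vertex_enum_bij[OF V])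
  define d where "d = inv_into {..<n} e"
  have d: "bij_betw d V {..<n}"
    unfolding d_def by (rule bij_betw_inv_into[OF e])
  have ed: "e (d v) = v" if "v \<in> V" for v
    using that e unfolding d_def by (metis bij_betw_inv_into_right)
  have eV: "e i \<in> V" if "i < n" for i
    using that e bij_betwE by blast
  have dn: "d v < n" if "v \<in> V" for v
    using that d bij_betwE by blast
  let ?A = "vertex_matrix V M"
  have A: "?A \<in> carrier_mat n n"
    unfolding vertex_matrix_def n_def by simp
  have A_ij: "?A $$ (i, j) = M (e i) (e j)" if "i < n" "j < n" for i j
    using that unfolding vertex_matrix_def n_def e_def by simp
  let ?B = "map_mat complex_of_real (char_matrix ?A \<mu>)"
  have B: "?B \<in> carrier_mat n n" using A by simp
  have "kernel_dim ?B + card (d ` c ` I) \<le> n"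
  proof (rule kernel_dim_add_card_le[OF B])
    show "d ` c ` I \<subseteq> {..<n}"
      using cV d bij_betw_imp_surj_on by blast
    fix x assume x: "x \<in> mat_kernel ?B" and supp: "\<And>i. i < n \<Longrightarrow> i \<notin> d ` c ` I \<Longrightarrow> x $ i = 0"
    have xn: "x \<in> carrier_vec n" and Bx: "?B *\<^sub>v x = 0\<^sub>v n"
      using mat_kernelD[OF B x] by auto
    define y where "y v = x $ d v" for v
    have xe: "x $ i = y (e i)" if "i < n" for i
      using that e unfolding y_def d_def by (simp add: bij_betw_def)
    have null: "(\<Sum>w\<in>V. of_real (M v w) * y w) = of_real \<mu> * y v" if v: "v \<in> V" for v
    proof -
      have "0 = (?B *\<^sub>v x) $ d v"
        using Bx dn[OF v] by simp
      also have "\<dots> = (\<Sum>j<n. of_real (M v (e j) - (if d v = j then \<mu> else 0)) * x $ j)"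
        using A B xn dn[OF v] ed[OF v]
        by (auto simp: scalar_prod_def atLeast0LessThan A_ij char_matrix_def intro!: sum.cong)
      also have "\<dots> = (\<Sum>j<n. of_real (M v (e j)) * y (e j)) - (\<Sum>j<n. if d v = j then of_real \<mu> * x $ j else 0)"
        unfolding sum_subtractf[symmetric] by (intro sum.cong) (auto simp: xe algebra_simps)
      also have "(\<Sum>j<n. of_real (M v (e j)) * y (e j)) = (\<Sum>w\<in>V. of_real (M v w) * y w)"
        unfolding e_def n_def by (rule sum_vertex_enum[OF V])
      also have "(\<Sum>j<n. if d v = j then of_real \<mu> * x $ j else 0) = of_real \<mu> * y v"
        using dn[OF v] by (simp add: y_def)
      finally show ?thesis by simp
    qed
    have "y v = 0" if "v \<in> V" for v
    proof (rule triangular_null_vector[OF V M null _ rV cV edge triangular that])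
      fix v assume "v \<in> V" "v \<notin> c ` I"
      then have "d v \<notin> d ` c ` I"
        using cV d by (metis bij_betw_def inj_on_image_mem_iff)
      then show "y v = 0"
        unfolding y_def using supp dn[OF \<open>v \<in> V\<close>] by blast
    qed
    then show "x = 0\<^sub>v n"
      using xn xe eV by (intro eq_vecI) auto
  qed
  moreover have "card (d ` c ` I) = card I"
  proof -
    have "inj_on d (c ` I)"
      using d cV unfolding bij_betw_def by (blast intro: inj_on_subset)
    then show ?thesis
      by (simp add: card_image c_inj)
  qed
  moreover have "?A $$ (i, j) = ?A $$ (j, i)" if "i < n" "j < n" for i j
    unfolding A_ij[OF that] A_ij[OF that(2,1)]
    by (rule edge_weight_commute[OF M eV eV]) (rule that)+
  then have "eigenvalue_mult ?A \<mu> = kernel_dim ?B"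
    unfolding eigenvalue_mult_def using order_char_poly_symmetric[OF A] by blast
  ultimately show ?thesis
    unfolding n_def by simp
qed

lemma vertex_degree_pos:
  assumes "simple_graph V E" "{v, w} \<in> E"
  shows "vertex_degree E v > 0"
proof -
  have "{u. {v, u} \<in> E} \<subseteq> V"
    using edge_ends_distinct[OF assms(1)] by blast
  then have "finite {u. {v, u} \<in> E}"
    using assms(1) finite_subset unfolding simple_graph_def by blast
  then show ?thesis
    unfolding vertex_degree_def using assms(2) by (auto simp: card_gt_0_iff)
qed

lemma symmetric_edge_weights_graph_matrices:
  assumes "simple_graph V E"
  shows "symmetric_edge_weights V E (adj_entry E)"
    and "symmetric_edge_weights V E (lap_entry E)"
    and "symmetric_edge_weights V E (norm_lap_entry E)"
proof -
  show "symmetric_edge_weights V E (adj_entry E)" "symmetric_edge_weights V E (lap_entry E)"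
    unfolding symmetric_edge_weights_def lap_entry_def adj_entry_def
    by (auto simp: insert_commute)
  have pos: "vertex_degree E v > 0 \<and> vertex_degree E w > 0" if "{v, w} \<in> E" for v w
    using that vertex_degree_pos[OF assms, of v w] vertex_degree_pos[OF assms, of w v]
    by (simp add: insert_commute)
  have "norm_lap_entry E v w = norm_lap_entry E w v" for v w
    unfolding norm_lap_entry_def by (simp add: insert_commute mult.commute)
  moreover have "norm_lap_entry E v w \<noteq> 0 \<longleftrightarrow> {v, w} \<in> E" if "v \<noteq> w" for v w
    unfolding norm_lap_entry_def using that pos[of v w] by simp
  ultimately show "symmetric_edge_weights V E (norm_lap_entry E)"
    unfolding symmetric_edge_weights_def by blast
qed

text \<open>The constant vector is an eigenvector. This makes the set of multiplicities nonempty, so that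
  its maximum is attained and positive.\<close>

lemma laplacian_eigenvalue_0:
  assumes G: "simple_graph V E"
  shows "eigenvalue (laplacian_matrix V E) 0"
proof -
  define n where "n = card V"
  have V: "finite V" "n > 0"
    using G unfolding simple_graph_def n_def by auto
  have L: "laplacian_matrix V E \<in> carrier_mat n n"
    unfolding laplacian_matrix_def vertex_matrix_def n_def by simp
  let ?one = "vec n (\<lambda>_. 1 :: real)"
  have row_sum: "(\<Sum>w\<in>V. lap_entry E v w) = 0" if "v \<in> V" for v
  proof -
    have "(\<Sum>w\<in>V. adj_entry E v w) = real (card (V \<inter> {w. {v, w} \<in> E}))"
      unfolding adj_entry_def using V(1) by (simp add: sum.If_cases)
    also have "V \<inter> {w. {v, w} \<in> E} = {w. {v, w} \<in> E}"
      using edge_ends_distinct[OF G] by blast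
    finally show ?thesis
      unfolding lap_entry_def using that V(1)
      by (simp add: sum_subtractf vertex_degree_def)
  qed
  have "laplacian_matrix V E *\<^sub>v ?one = 0\<^sub>v n"
  proof (rule eq_vecI)
    fix i assume "i < dim_vec (0\<^sub>v n :: real vec)"
    then have i: "i < n" by simp
    have "(laplacian_matrix V E *\<^sub>v ?one) $ i
        = (\<Sum>j<card V. lap_entry E (vertex_enum V i) (vertex_enum V j))"
      using i by (simp add: laplacian_matrix_def vertex_matrix_def n_def scalar_prod_def atLeast0LessThan)
    also have "\<dots> = 0"
      unfolding sum_vertex_enum[OF V(1)]
      using row_sum i vertex_enum_bij[OF V(1)] unfolding n_def by (auto dest: bij_betwE)
    finally show "(laplacian_matrix V E *\<^sub>v ?one) $ i = 0\<^sub>v n $ i"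
      using i by simp
  qed (use L in simp)
  moreover have "?one \<noteq> 0\<^sub>v n"
    using V(2) by (metis index_vec index_zero_vec(1) zero_neq_one)
  ultimately have "eigenvector (laplacian_matrix V E) ?one 0"
    unfolding eigenvector_def using L by auto
  then show ?thesis
    unfolding eigenvalue_def by blast
qed

lemma eigenvalue_mult_le: "A \<in> carrier_mat n n \<Longrightarrow> eigenvalue_mult A \<mu> \<le> n"
  unfolding eigenvalue_mult_def
  using order_degree[of "char_poly A" \<mu>] degree_monic_char_poly[of A n] by fastforce

lemma eigenvalue_mult_pos:
  assumes A: "A \<in> carrier_mat n n" and "eigenvalue A \<mu>"
  shows "eigenvalue_mult A \<mu> > 0"
proof -
  have "poly (char_poly A) \<mu> = 0"
    using assms eigenvalue_root_char_poly by blast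
  moreover have "char_poly A \<noteq> 0"
    using degree_monic_char_poly[OF A] by auto
  ultimately show ?thesis
    unfolding eigenvalue_mult_def by (simp add: order_root)
qed

lemma max_mult_bounds:
  assumes G: "simple_graph V E"
  shows "max_mult V E > 0"
    and "\<exists>M \<mu>. symmetric_edge_weights V E M \<and> max_mult V E = eigenvalue_mult (vertex_matrix V M) \<mu>"
    and "max_mult V E \<le> card V"
proof -
  define As where "As = {laplacian_matrix V E, normalized_laplacian_matrix V E, adjacency_matrix V E}"
  define X where "X = {eigenvalue_mult A \<mu> | A \<mu>. A \<in> As \<and> eigenvalue A \<mu>}"
  have mm: "max_mult V E = Max X"
    unfolding max_mult_def X_def As_def ..
  have shape: "A \<in> carrier_mat (card V) (card V)" if "A \<in> As" for A
    using that unfolding As_def laplacian_matrix_def normalized_laplacian_matrix_def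
      adjacency_matrix_def vertex_matrix_def by auto
  have "X \<subseteq> {..card V}"
    unfolding X_def using eigenvalue_mult_le[OF shape] by auto
  then have fin: "finite X"
    using finite_subset by blast
  have L: "laplacian_matrix V E \<in> As"
    unfolding As_def by simp
  have L_in: "eigenvalue_mult (laplacian_matrix V E) 0 \<in> X"
    unfolding X_def using L laplacian_eigenvalue_0[OF G] by blast
  have "eigenvalue_mult (laplacian_matrix V E) 0 \<le> max_mult V E"
    unfolding mm using fin L_in by simp
  then show "max_mult V E > 0"
    using eigenvalue_mult_pos[OF shape[OF L] laplacian_eigenvalue_0[OF G]] by linarith
  have "Max X \<in> X"
    using fin L_in Max_in by blast
  then obtain A \<mu> where A: "A \<in> As" "max_mult V E = eigenvalue_mult A \<mu>"
    unfolding mm X_def by blast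
  then show "max_mult V E \<le> card V"
    using eigenvalue_mult_le shape by metis
  show "\<exists>M \<mu>. symmetric_edge_weights V E M \<and> max_mult V E = eigenvalue_mult (vertex_matrix V M) \<mu>"
    using A symmetric_edge_weights_graph_matrices[OF G]
    unfolding As_def laplacian_matrix_def normalized_laplacian_matrix_def adjacency_matrix_def
    by blast
qed

section \<open>A forcing order in the complete binary tree\<close>

lemma cbt_leaves_eq: "cbt_leaves (Suc m) = {l. length l = m}"
proof (induction m)
  case (Suc m)
  then show ?case by (auto simp: length_Suc_conv)
qed auto

lemma cbt_verts_eq: "cbt_verts (Suc m) = {l. length l \<le> m}"
proof (induction m)
  case (Suc m)
  have "{b # l | b l. l \<in> cbt_leaves (Suc m)} = {l. length l = Suc m}"
    unfolding cbt_leaves_eq by (auto simp: length_Suc_conv)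
  then show ?case
    using Suc by (auto simp: le_Suc_eq)
qed auto

lemma cbt_edges_eq: "cbt_edges (Suc m) = {{l, b # l} | b l. length l < m}"
proof (induction m)
  case (Suc m)
  have "cbt_edges (Suc (Suc m)) = {{l, b # l} | b l. length l < m} \<union> {{l, b # l} | b l. length l = m}"
    by (simp only: cbt_edges.simps Suc cbt_leaves_eq mem_Collect_eq)
  then show ?case
    by (auto simp: less_Suc_eq)
qed auto

lemma cbt_edge_iff:
  "{u, v} \<in> cbt_edges (Suc m) \<longleftrightarrow>
    length u < m \<and> (\<exists>b. v = b # u) \<or> length v < m \<and> (\<exists>b. u = b # v)"
  unfolding cbt_edges_eq by (auto simp: doubleton_eq_iff)

lemma card_bool_lists_shorter:
  "finite {l :: bool list. length l < m} \<and> card {l :: bool list. length l < m} = 2 ^ m - 1"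
proof (induction m)
  case (Suc m)
  have split: "{l :: bool list. length l < Suc m} = {l. length l < m} \<union> {l. length l = m}"
    by auto
  have fin: "finite {l :: bool list. length l = m}" and card: "card {l :: bool list. length l = m} = 2 ^ m"
    using finite_lists_length_eq[of "UNIV :: bool set" m] card_lists_length_eq[of "UNIV :: bool set" m]
    by (auto simp: card_UNIV_bool)
  have "card {l :: bool list. length l < Suc m} = (2 ^ m - 1) + 2 ^ m"
    unfolding split using Suc fin card by (subst card_Un_disjoint) auto
  then show ?case
    unfolding split using Suc fin by simp
qed simp

lemma card_cbt_verts: "k \<ge> 1 \<Longrightarrow> card (cbt_verts k) = 2 ^ k - 1"
  using card_bool_lists_shorter[of k] by (cases k) (auto simp: cbt_verts_eq less_Suc_eq_le)

text \<open>In the list model the children of \<open>l\<close> are \<open>b # l\<close> and its parent is \<open>tl l\<close>; \<open>False\<close> is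
  read as "left". The root \<open>[]\<close> is excluded from the spine since it has no parent and is paired
  with its right child instead. Below, \<open>m\<close> is the depth of the tree minus one, i.e. the length of
  its leaves.\<close>

definition on_left_spine :: "bool list \<Rightarrow> bool" where
  "on_left_spine l \<longleftrightarrow> l \<noteq> [] \<and> set l \<subseteq> {False}"

text \<open>The column paired with row \<open>l\<close>: the parent on the spine, the right child elsewhere.\<close>

definition forced_nbr :: "bool list \<Rightarrow> bool list" where
  "forced_nbr l = (if on_left_spine l then tl l else True # l)"

text \<open>The order of elimination: up along the left spine, starting at the leaf, and then downwards
  through all other inner vertices. Ranks on the spine are below \<open>m\<close>, all others above.\<close>

definition forcing_rank :: "nat \<Rightarrow> bool list \<Rightarrow> nat" where
  "forcing_rank m l = (if on_left_spine l then m - length l else Suc m + length l)"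

text \<open>The rows: all inner vertices and the leftmost leaf.\<close>

definition forcing_verts :: "nat \<Rightarrow> bool list set" where
  "forcing_verts m = insert (replicate m False) {l. length l < m}"

lemma on_left_spine_iff: "on_left_spine l \<longleftrightarrow> (\<exists>j. l = replicate (Suc j) False)"
proof
  assume "on_left_spine l"
  then have "l = replicate (length l) False" "length l > 0"
    unfolding on_left_spine_def by (auto intro!: replicate_eqI[of l "length l"])
  then show "\<exists>j. l = replicate (Suc j) False"
    by (metis gr0_implies_Suc)
qed (auto simp: on_left_spine_def)

lemma card_forcing_verts: "card (forcing_verts m) = 2 ^ m"
  unfolding forcing_verts_def using card_bool_lists_shorter[of m] by simp

lemma inj_forced_nbr: "inj forced_nbr"
proof (rule injI)
  fix l l' assume "forced_nbr l = forced_nbr l'"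
  then show "l = l'"
    unfolding forced_nbr_def
    by (auto split: if_splits simp: on_left_spine_iff)
       (metis in_set_replicate list.set_intros(1))+
qed

lemma forcing_verts_cases:
  assumes "l \<in> forcing_verts m" "m \<ge> 1"
  obtains (spine) j where "l = replicate (Suc j) False" "j < m" "on_left_spine l"
  | (other) "length l < m" "\<not> on_left_spine l"
proof (cases "on_left_spine l")
  case True
  then obtain j where "l = replicate (Suc j) False"
    unfolding on_left_spine_iff by blast
  then show ?thesis
    using True assms(1) spine[of j] unfolding forcing_verts_def
    by (auto dest: arg_cong[of _ _ length])
next
  case False
  have "on_left_spine (replicate m False)"
    using assms(2) unfolding on_left_spine_iff by (metis Suc_le_D One_nat_def)
  then show ?thesis
    using False assms other unfolding forcing_verts_def by auto
qed

lemma forced_nbr_edge: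
  assumes "l \<in> forcing_verts m" "m \<ge> 1"
  shows "l \<noteq> forced_nbr l" "{l, forced_nbr l} \<in> cbt_edges (Suc m)"
  by (rule forcing_verts_cases[OF assms]; auto simp: forced_nbr_def cbt_edge_iff)+

text \<open>The right child of a spine vertex is not a column, as right children are only paired with
  vertices off the spine. Hence a spine row meets only columns on the spine or at the root, and
  apart from its own column these belong to deeper spine rows. The left child of a vertex off the
  spine is a column only if that vertex is the root, and then it belongs to a spine row. So a row
  off the spine meets, apart from its own right child, at most itself, its parent and a left
  child, which as columns belong to shallower rows or to the spine.\<close>

lemma forcing_rank_decreases:
  assumes l: "l \<in> forcing_verts m" and l': "l' \<in> forcing_verts m" and m: "m \<ge> 1"
    and "l \<noteq> l'"
    and nbr: "forced_nbr l' = l \<or> {l, forced_nbr l'} \<in> cbt_edges (Suc m)"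
  shows "forcing_rank m l' < forcing_rank m l"
  using l m
proof (cases l rule: forcing_verts_cases)
  case l: (spine j)
  show ?thesis
    using l' m
  proof (cases l' rule: forcing_verts_cases)
    case (spine j')
    then have "forced_nbr l' = replicate j' False"
      by (simp add: forced_nbr_def)
    then have "j' = length l \<or> j' = Suc (length l) \<or> length l = Suc j'"
      using nbr unfolding cbt_edge_iff by (metis length_Cons length_replicate)
    then have "j < j'"
      using l spine \<open>l \<noteq> l'\<close> by auto
    then show ?thesis
      using l spine by (auto simp: forcing_rank_def)
  next
    case other
    have "True \<notin> set l" using l by auto
    then show ?thesis
      using other nbr \<open>l \<noteq> l'\<close> by (auto simp: forced_nbr_def cbt_edge_iff)
  qed
next
  case l: other
  show ?thesis
    using l' m
  proof (cases l' rule: forcing_verts_cases)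
    case (spine j')
    then show ?thesis
      using l by (auto simp: forcing_rank_def)
  next
    case other
    then show ?thesis
      using l nbr \<open>l \<noteq> l'\<close> by (auto simp: forced_nbr_def forcing_rank_def cbt_edge_iff)
  qed
qed

section \<open>Induced complete binary trees and multiplicities\<close>

text \<open>The pattern of rows and columns is transported into \<open>G\<close> along the isomorphism. For \<open>m = 0\<close> the
  statement fails for edgeless graphs, where a single eigenvalue has multiplicity \<open>card V\<close>.\<close>

lemma eigenvalue_mult_induced_cbt:
  assumes G: "simple_graph V E" and M: "symmetric_edge_weights V E M"
    and tree: "has_induced_cbt V E (Suc m)" and m: "m \<ge> 1"
  shows "eigenvalue_mult (vertex_matrix V M) \<mu> + 2 ^ m \<le> card V"
proof -
  obtain W \<phi> where W: "W \<subseteq> V" and \<phi>: "bij_betw \<phi> W (cbt_verts (Suc m))"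
    and iso: "\<forall>u\<in>W. \<forall>v\<in>W. {u, v} \<in> induced_edges E W \<longleftrightarrow> {\<phi> u, \<phi> v} \<in> cbt_edges (Suc m)"
    using tree unfolding has_induced_cbt_def is_cbt_def graph_iso_def by blast
  define h where "h = inv_into W \<phi>"
  have h: "bij_betw h (cbt_verts (Suc m)) W"
    unfolding h_def by (rule bij_betw_inv_into[OF \<phi>])
  have hW: "h l \<in> W" and \<phi>h: "\<phi> (h l) = l" if "l \<in> cbt_verts (Suc m)" for l
    using that h \<phi> unfolding h_def by (auto dest: bij_betwE simp: bij_betw_inv_into_right)
  have edges: "{h l, h l'} \<in> E \<longleftrightarrow> {l, l'} \<in> cbt_edges (Suc m)"
    if "l \<in> cbt_verts (Suc m)" "l' \<in> cbt_verts (Suc m)" for l l'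
    using iso hW[OF that(1)] hW[OF that(2)] \<phi>h that unfolding induced_edges_def by auto
  have hinj: "inj_on h (cbt_verts (Suc m))"
    using h by (rule bij_betw_imp_inj_on)
  let ?I = "forcing_verts m"
  have I: "l \<in> cbt_verts (Suc m)" if "l \<in> ?I" for l
    using that unfolding forcing_verts_def cbt_verts_eq by auto
  have fI: "forced_nbr l \<in> cbt_verts (Suc m)" if "l \<in> ?I" for l
    using forced_nbr_edge(2)[OF that m] by (auto simp: cbt_edge_iff cbt_verts_eq)
  have "eigenvalue_mult (vertex_matrix V M) \<mu> + card ?I \<le> card V"
  proof (rule eigenvalue_mult_add_card_le[OF _ M])
    show "finite V"
      using G unfolding simple_graph_def by blast
    show "h ` ?I \<subseteq> V" "(h \<circ> forced_nbr) ` ?I \<subseteq> V"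
      using I fI hW W by auto
    show "inj_on (h \<circ> forced_nbr) ?I"
      using fI hinj inj_forced_nbr by (intro comp_inj_on) (auto intro: inj_on_subset)
  next
    fix l assume l: "l \<in> ?I"
    show "h l \<noteq> (h \<circ> forced_nbr) l \<and> {h l, (h \<circ> forced_nbr) l} \<in> E"
      using forced_nbr_edge[OF l m] edges[OF I fI, OF l l] edge_ends_distinct[OF G] by auto
  next
    fix l l' assume l: "l \<in> ?I" "l' \<in> ?I" "l \<noteq> l'"
      and "(h \<circ> forced_nbr) l' = h l \<or> {h l, (h \<circ> forced_nbr) l'} \<in> E"
    then have "forced_nbr l' = l \<or> {l, forced_nbr l'} \<in> cbt_edges (Suc m)"
      using edges[OF I fI, OF l(1,2)] inj_onD[OF hinj _ fI I, OF _ l(2,1)] by auto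
    then show "forcing_rank m l' < forcing_rank m l"
      using forcing_rank_decreases l m by blast
  qed
  then show ?thesis
    by (simp add: card_forcing_verts)
qed

lemma card_cbt_le:
  assumes "simple_graph V E" "has_induced_cbt V E d"
  shows "2 ^ d - 1 \<le> card V"
proof -
  obtain W \<phi> where "W \<subseteq> V" "bij_betw \<phi> W (cbt_verts d)" "d \<ge> 1"
    using assms(2) unfolding has_induced_cbt_def is_cbt_def graph_iso_def by blast
  then show ?thesis
    using assms(1) card_mono[of V W] bij_betw_same_card card_cbt_verts
    unfolding simple_graph_def by metis
qed

lemma induced_cbt_depth_1:
  assumes "simple_graph V E"
  shows "has_induced_cbt V E 1"
proof -
  obtain v where v: "v \<in> V"
    using assms unfolding simple_graph_def by blast
  have "{v} \<notin> E"
    using edge_ends_distinct[OF assms, of v v] by auto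
  then have "is_cbt {v} (induced_edges E {v}) 1"
    unfolding is_cbt_def graph_iso_def induced_edges_def
    by (auto intro!: exI[of _ "\<lambda>_. []"] simp: bij_betw_def)
  then show ?thesis
    unfolding has_induced_cbt_def using v by blast
qed

lemma is_cbt_imp_has_induced_cbt:
  assumes "simple_graph V E" "is_cbt V E d"
  shows "has_induced_cbt V E d"
proof -
  have "induced_edges E V = E"
    using assms(1) unfolding induced_edges_def simple_graph_def by blast
  then show ?thesis
    using assms(2) unfolding has_induced_cbt_def by auto
qed

theorem corollary24:
  fixes V :: "'a set" and E :: "'a set set" and k :: nat
  assumes "simple_graph V E"
    and "k = Max {d. d \<ge> 1 \<and> has_induced_cbt V E d}"
  shows "real k \<le> 1 + log 2 (real (card V) - real (max_mult V E)) \<and>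
    (is_cbt V E 2 \<longrightarrow> real k = 1 + log 2 (real (card V) - real (max_mult V E)))"
proof -
  note G = assms(1)
  define D where "D = {d. d \<ge> 1 \<and> has_induced_cbt V E d}"
  have "d \<le> card V" if "d \<in> D" for d
    using card_cbt_le[OF G, of d] that less_exp[of d] unfolding D_def mem_Collect_eq by linarith
  then have "D \<subseteq> {..card V}" by auto
  then have D: "finite D" "D \<noteq> {}"
    using finite_subset induced_cbt_depth_1[OF G] unfolding D_def by auto
  have "k \<in> D"
    using Max_in[OF D] assms(2) unfolding D_def by simp
  then obtain m where k: "k = Suc m" "has_induced_cbt V E (Suc m)"
    unfolding D_def by (cases k) auto
  have bound: "max_mult V E + 2 ^ m \<le> card V" if "m \<ge> 1"
    using max_mult_bounds(2)[OF G] eigenvalue_mult_induced_cbt[OF G _ k(2) that] by metis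
  have "real k \<le> 1 + log 2 (real (card V) - real (max_mult V E))"
  proof (cases "m \<ge> 1")
    case True
    then have "real (max_mult V E + 2 ^ m) \<le> real (card V)"
      using bound by (simp only: of_nat_le_iff)
    then have "(2 :: real) ^ m \<le> real (card V) - real (max_mult V E)"
      by simp
    then have "log 2 (2 ^ m) \<le> log 2 (real (card V) - real (max_mult V E))"
      by (intro log_mono) auto
    then show ?thesis
      using k(1) by simp
  next
    case False
    define n where "n = card V - max_mult V E"
    have n: "real (card V) - real (max_mult V E) = real n"
      unfolding n_def using max_mult_bounds(3)[OF G] by simp
    \<comment> \<open>Either \<open>n \<ge> 1\<close>, or \<open>n = 0\<close> and \<open>log 2 0 = 0\<close>.\<close>
    have "log 2 (real n) \<ge> 0"
      by (cases "n = 0") (auto simp: log_def)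
    then show ?thesis
      using False k(1) n by simp
  qed
  moreover have "real k = 1 + log 2 (real (card V) - real (max_mult V E))" if "is_cbt V E 2"
  proof -
    have V: "card V = 3"
      using that card_cbt_verts[of 2] unfolding is_cbt_def graph_iso_def
      by (auto dest: bij_betw_same_card)
    have "2 \<in> D"
      using is_cbt_imp_has_induced_cbt[OF G that] unfolding D_def by simp
    then have "k \<ge> 2"
      using D assms(2) unfolding D_def by simp
    then have "m \<ge> 1" using k(1) by simp
    have "m < 2"
    proof (rule ccontr)
      assume "\<not> m < 2"
      then have "2 ^ 3 \<le> (2 :: nat) ^ Suc m"
        by (intro power_increasing) auto
      then show False
        using card_cbt_le[OF G k(2)] V by simp
    qed
    then have m: "m = 1" using \<open>m \<ge> 1\<close> by simp
    have "max_mult V E = 1"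
      using bound m V max_mult_bounds(1)[OF G] by simp
    then show ?thesis
      using k(1) m V by simp
  qed
  ultimately show ?thesis by blast
qed

end
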